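(* Let $k$ be a positive integer and let $T,\overline{T}$ be two $k$-ary trees with $n$ internal vertices. Then $T$ and $\overline{T}$ are connected by a sequence of flips, i.e. there is a sequence of $k$-ary trees $T=T_0\sim T_1\sim\cdots\sim T_l=\overline{T}$ in which each tree is a flip of the preceding one.
   Context: A $k$-ary tree is a (finite) rooted plane tree in which each vertex has either $k$ children (such a vertex is called internal) or no children (a leaf). Trees are considered up to isomorphism of rooted plane trees. For a vertex $v$ of $T$, $T_v$ denotes the subtree consisting of $v$ and all its descendants. If $v$ is internal, its children listed left to right are $v',v'',\ldots,v^{(k)}$, and $T_v',T_v'',\ldots,T_v^{(k)}$ are the subtrees they generate. Flips: let $v$ be an internal vertex of $T$ and let $x=v^{(i)}$ be a child of $v$ which is itself internal. Consider the list of pairwise disjoint subtrees, in left-to-right order, $$T_v',\ldots,T_v^{(i-1)},\,T_x',T_x'',\ldots,T_x^{(k)},\,T_v^{(i+1)},\ldots,T_v^{(k)}.$$ A $k$-ary tree $\overline{T}$ is a flip of $T$, written $T\sim\overline{T}$, if $\overline{T}$ is isomorphic to $T$ outside of $T_v$ (i.e. $\overline T$ is obtained from $T$ by replacing $T_v$ by another $k$-ary tree, with root again called $v$) and there is some internal child $y=v^{(j)}$ of $v$ in $\overline{T}$ such that, when one forms in $\overline{T}$ the list $$\overline{T}_v',\ldots,\overline{T}_v^{(j-1)},\,\overline{T}_y',\overline{T}_y'',\ldots,\overline{T}_y^{(k)},\,\overline{T}_v^{(j+1)},\ldots,\overline{T}_v^{(k)},$$ corresponding trees in this list and in the list $T_v',\ldots,T_v^{(i-1)},\,T_x',T_x'',\ldots,T_x^{(k)},\,T_v^{(i+1)},\ldots,T_v^{(k)}$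 for $x$ in $T$ are isomorphic. *)

theory Defs
  imports Main
begin

text \<open>
  Finite rooted plane trees, each given by the left-to-right list of the subtrees at the children
  of its root. A leaf is \<open>Node []\<close>. Isomorphism of rooted plane trees is equality
  in this type.
\<close>

datatype plane_tree = Node (children: "plane_tree list")

definition internal :: "plane_tree \<Rightarrow> bool" where
  "internal t \<longleftrightarrow> children t \<noteq> []"

fun kary :: "nat \<Rightarrow> plane_tree \<Rightarrow> bool" where
  "kary k (Node ts) \<longleftrightarrow> (ts = [] \<or> length ts = k) \<and> (\<forall>t\<in>set ts. kary k t)"

fun num_internal :: "plane_tree \<Rightarrow> nat" where
  "num_internal (Node ts) =
     (if internal (Node ts) then 1 else 0) + sum_list (map num_internal ts)"

text \<open>
  A vertex is addressed by the path of child indices, counted from 0, leading to it from the root.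
  The functions \<open>subtree_at\<close> and \<open>replace_at\<close> are meaningful only at
  addresses satisfying \<open>is_vertex\<close>.
\<close>

primrec is_vertex :: "plane_tree \<Rightarrow> nat list \<Rightarrow> bool" where
  "is_vertex t [] \<longleftrightarrow> True"
| "is_vertex t (i # p) \<longleftrightarrow> i < length (children t) \<and> is_vertex (children t ! i) p"

primrec subtree_at :: "plane_tree \<Rightarrow> nat list \<Rightarrow> plane_tree" where
  "subtree_at t [] = t"
| "subtree_at t (i # p) = subtree_at (children t ! i) p"

primrec replace_at :: "plane_tree \<Rightarrow> nat list \<Rightarrow> plane_tree \<Rightarrow> plane_tree" where
  "replace_at t [] s = s"
| "replace_at t (i # p) s =
     Node ((children t)[i := replace_at (children t ! i) p s])"

text \<open>
  With root \<open>v\<close> and its \<open>i\<close>-th child \<open>x\<close>, this is the list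
  of the subtrees at the children of \<open>v\<close>, with the subtree at \<open>x\<close>
  replaced by the subtrees at the children of \<open>x\<close>.
\<close>

definition expand_child :: "plane_tree \<Rightarrow> nat \<Rightarrow> plane_tree list" where
  "expand_child t i =
     take i (children t) @ children (children t ! i) @ drop (Suc i) (children t)"

text \<open>
  The vertex \<open>v\<close> has address \<open>p\<close>, and \<open>S\<close> is the subtree
  at \<open>v\<close> after the flip. The case \<open>S = subtree_at T p\<close> is not excluded.
\<close>

definition flip :: "nat \<Rightarrow> plane_tree \<Rightarrow> plane_tree \<Rightarrow> bool" where
  "flip k T T' \<longleftrightarrow>
     kary k T \<and> kary k T' \<and>
     (\<exists>p S i j.
        is_vertex T p \<and> T' = replace_at T p S \<and>
        i < length (children (subtree_at T p)) \<and> internal (children (subtree_at T p) ! i) \<and>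
        j < length (children S) \<and> internal (children S ! j) \<and>
        expand_child (subtree_at T p) i = expand_child S j)"

end

theory Submission
  imports Defs
begin

text \<open>
  Every tree is joined to one normal form depending only on \<open>k\<close> and the number of
  internal vertices, the left comb; since flips are reversible, two trees with equally many internal
  vertices are then joined to each other through it.

  To reach the comb, first turn the root's children other than the first into leaves. If such a child
  \<open>x\<close> is internal, expand it: this gives a list of \<open>2k - 1\<close> trees. Regrouping
  the first \<open>k\<close> of them as the first child is a flip
  (\<open>flip_regroup_first\<close>). Afterwards the non-first children are the last \<open>k - 1\<close>
  trees of the list; they are taken from the old non-first children and the children of
  \<open>x\<close>, and \<open>x\<close> itself has disappeared from among them. So the number of internal
  vertices below non-first children drops, and the process ends with all of them leaves
  (\<open>flips_to_single_branch\<close>). The first child has one internal vertex less than the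
  whole tree, so induction turns it into a comb.
\<close>

lemma not_internal_iff: "\<not> internal t \<longleftrightarrow> t = Node []"
  by (cases t) (simp add: internal_def)

lemma num_internal_eq_0_iff: "num_internal t = 0 \<longleftrightarrow> t = Node []"
  by (cases t) (auto simp: internal_def)

lemma num_internal_internal:
  "internal t \<Longrightarrow> num_internal t = Suc (sum_list (map num_internal (children t)))"
  by (cases t) simp

lemma kary_internal:
  assumes "kary k t" "internal t"
  shows "length (children t) = k" "\<forall>c\<in>set (children t). kary k c"
  using assms by (cases t; simp add: internal_def)+

lemma replace_at_is_vertex: "is_vertex T p \<Longrightarrow> is_vertex (replace_at T p S) p"
  by (induction p arbitrary: T) auto

lemma subtree_at_replace_at: "is_vertex T p \<Longrightarrow> subtree_at (replace_at T p S) p = S"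
  by (induction p arbitrary: T) auto

lemma replace_at_undo:
  "is_vertex T p \<Longrightarrow> replace_at (replace_at T p S) p (subtree_at T p) = T"
  by (induction p arbitrary: T) (auto simp: plane_tree.expand)

lemma flip_sym:
  assumes "flip k T T'"
  shows "flip k T' T"
proof -
  obtain p S i j where karys: "kary k T" "kary k T'"
    and p: "is_vertex T p" and T': "T' = replace_at T p S"
    and i: "i < length (children (subtree_at T p))" "internal (children (subtree_at T p) ! i)"
    and j: "j < length (children S)" "internal (children S ! j)"
    and eq: "expand_child (subtree_at T p) i = expand_child S j"
    using assms unfolding flip_def by blast
  show ?thesis unfolding flip_def
  proof (intro conjI exI)
    show "T = replace_at T' p (subtree_at T p)" using p T' replace_at_undo by simp
    show "is_vertex T' p" using p T' replace_at_is_vertex by simp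
    show "j < length (children (subtree_at T' p))" "internal (children (subtree_at T' p) ! j)"
      "expand_child (subtree_at T' p) j = expand_child (subtree_at T p) i"
      using p T' j eq subtree_at_replace_at by simp_all
  qed (use karys i in auto)
qed

lemma flip_first_child:
  assumes "flip k s s'" "kary k (Node (s # us))"
  shows "flip k (Node (s # us)) (Node (s' # us))"
proof -
  obtain p S i j where "kary k s'" "is_vertex s p \<and> s' = replace_at s p S \<and>
        i < length (children (subtree_at s p)) \<and> internal (children (subtree_at s p) ! i) \<and>
        j < length (children S) \<and> internal (children S ! j) \<and>
        expand_child (subtree_at s p) i = expand_child S j"
    using assms(1) unfolding flip_def by blast
  then show ?thesis using assms(2) unfolding flip_def
    by (intro conjI exI[of _ "0 # p"] exI[of _ S] exI[of _ i] exI[of _ j]) auto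
qed

lemma flips_first_child:
  assumes "(flip k)\<^sup>*\<^sup>* s s'" "kary k (Node (s # us))"
  shows "(flip k)\<^sup>*\<^sup>* (Node (s # us)) (Node (s' # us))"
  using assms
proof (induction rule: rtranclp_induct)
  case (step y z)
  have "kary k (Node (y # us))"
    using step.hyps(2) step.prems by (simp add: flip_def)
  then show ?case
    using flip_first_child step.hyps(2) step.IH[OF step.prems] by (meson rtranclp.simps)
qed simp

text \<open>
  The definition of a flip depends on the new subtree only through its expanded list. So any
  bracketing of \<open>k\<close> consecutive trees of \<open>E\<close> is a flip; bracketing the first
  \<open>k\<close> pushes as much as possible into the first child.
\<close>

lemma flip_regroup_first:
  assumes "kary k (Node ts)" "i < length ts" "internal (ts ! i)"
  defines "E \<equiv> expand_child (Node ts) i"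
  shows "flip k (Node ts) (Node (Node (take k E) # drop k E))"
proof -
  have len: "length ts = k" and kary_ts: "\<forall>t\<in>set ts. kary k t"
    using assms(1,2) by auto
  have "kary k (ts ! i)" using kary_ts assms(2) by simp
  note x = kary_internal[OF this assms(3)]
  have kary_E: "\<forall>t\<in>set E. kary k t"
    using kary_ts x(2) by (auto simp: E_def expand_child_def dest: in_set_takeD in_set_dropD)
  have len_E: "length E = 2 * k - 1"
    using x(1) len assms(2) by (simp add: E_def expand_child_def)
  have "kary k (Node (Node (take k E) # drop k E))"
    using kary_E len_E len assms(2) by (auto dest: in_set_takeD in_set_dropD)
  moreover have "internal (Node (take k E))"
    using len_E len assms(2) by (auto simp: internal_def)
  moreover have "expand_child (Node (Node (take k E) # drop k E)) 0 = E"
    by (simp add: expand_child_def)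
  ultimately show ?thesis using assms unfolding flip_def
    by (intro conjI exI[of _ "[]"] exI[of _ "Node (Node (take k E) # drop k E)"]
        exI[of _ i] exI[of _ 0]) auto
qed

text \<open>
  The induction is on the number of internal vertices below the non-first children. The expanded
  child has index at least 1, so that it counts in this number before the flip but not after.
\<close>

lemma flips_to_single_branch:
  assumes "kary k (Node ts)" "ts \<noteq> []"
  shows "\<exists>s. kary k s \<and> num_internal (Node ts) = Suc (num_internal s) \<and>
           (flip k)\<^sup>*\<^sup>* (Node ts) (Node (s # replicate (k - 1) (Node [])))"
  using assms
proof (induction "sum_list (map num_internal (tl ts))" arbitrary: ts rule: less_induct)
  case less
  have len: "length ts = k" using less.prems by auto
  obtain t us where ts: "ts = t # us" using less.prems(2) by (cases ts) auto
  show ?case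
  proof (cases "\<forall>u\<in>set us. u = Node []")
    case True
    then have us: "us = replicate (k - 1) (Node [])"
      using len ts by (auto intro: replicate_eqI)
    have "num_internal (Node ts) = Suc (num_internal t)"
      unfolding ts us by (simp add: internal_def sum_list_replicate)
    then show ?thesis using less.prems(1) ts us by auto
  next
    case False
    then obtain j where j: "j < length us" "internal (us ! j)"
      by (metis in_set_conv_nth not_internal_iff)
    define cs where "cs = children (us ! j)"
    define E where "E = expand_child (Node ts) (Suc j)"
    define vs where "vs = Node (take k E) # drop k E"
    have E: "E = (t # take j us) @ cs @ drop (Suc j) us"
      by (simp add: E_def cs_def expand_child_def ts)
    have "kary k (us ! j)" using less.prems(1) j(1) by (auto simp: ts)
    then have len_cs: "length cs = k"
      using kary_internal(1) j(2) unfolding cs_def by blast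
    have flip: "flip k (Node ts) (Node vs)"
      unfolding vs_def E_def using flip_regroup_first less.prems(1) j ts by simp
    then have kary_vs: "kary k (Node vs)" by (simp add: flip_def)
    let ?N = "\<lambda>xs. sum_list (map num_internal xs)"
    have N_us: "?N us = ?N (take j us) + Suc (?N cs) + ?N (drop (Suc j) us)"
      using num_internal_internal[OF j(2)] j(1)
      by (subst id_take_nth_drop[OF j(1)]) (simp add: cs_def)
    have split_E: "?N E = ?N (take k E) + ?N (drop k E)"
      by (metis append_take_drop_id map_append sum_list_append)
    \<comment> \<open>The new first child takes up \<open>t\<close>, the \<open>j\<close> trees before the expanded one,
      and the first \<open>k - Suc j\<close> trees of \<open>cs\<close>.\<close>
    have "drop k E = drop (k - Suc j) cs @ drop (Suc j) us"
      using j(1) len ts len_cs unfolding E by auto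
    moreover have "?N (drop (k - Suc j) cs) \<le> ?N cs"
      by (metis append_take_drop_id le_add2 map_append sum_list_append)
    ultimately have "?N (tl vs) < ?N (tl ts)"
      using N_us by (simp add: vs_def ts)
    from less.hyps[OF this kary_vs] obtain s where s: "kary k s"
      "num_internal (Node vs) = Suc (num_internal s)"
      "(flip k)\<^sup>*\<^sup>* (Node vs) (Node (s # replicate (k - 1) (Node [])))"
      by (auto simp: vs_def)
    have "take k E \<noteq> []" using len ts by (auto simp: E)
    then have "num_internal (Node vs) = Suc (Suc (?N E))"
      using split_E by (simp add: vs_def internal_def)
    also have "\<dots> = num_internal (Node ts)"
      using N_us by (simp add: ts internal_def E)
    finally show ?thesis
      using s flip by (metis converse_rtranclp_into_rtranclp)
  qed
qed

primrec left_comb :: "nat \<Rightarrow> nat \<Rightarrow> plane_tree" where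
  "left_comb k 0 = Node []"
| "left_comb k (Suc n) = Node (left_comb k n # replicate (k - 1) (Node []))"

lemma flips_to_left_comb:
  assumes "k \<ge> 1" "kary k T" "num_internal T = n"
  shows "(flip k)\<^sup>*\<^sup>* T (left_comb k n)"
  using assms(2,3)
proof (induction n arbitrary: T)
  case 0
  then show ?case by (simp add: num_internal_eq_0_iff)
next
  case (Suc n)
  obtain ts where T: "T = Node ts" by (cases T)
  moreover have "ts \<noteq> []" using Suc.prems(2) T by (auto simp: internal_def)
  ultimately obtain s where s: "kary k s" "num_internal s = n"
    "(flip k)\<^sup>*\<^sup>* T (Node (s # replicate (k - 1) (Node [])))"
    using flips_to_single_branch[of k ts] Suc.prems by auto
  have "kary k (Node (s # replicate (k - 1) (Node [])))"
    using s(1) assms(1) by simp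
  then show ?case
    using flips_first_child[OF Suc.IH[OF s(1,2)]] s(3) by (auto intro: rtranclp_trans)
qed

theorem theorem4p1:
  fixes k n :: nat and T T' :: plane_tree
  assumes "k \<ge> 1"
    and "kary k T" and "kary k T'"
    and "num_internal T = n" and "num_internal T' = n"
  shows "\<exists>(l::nat) (U :: nat \<Rightarrow> plane_tree).
           U 0 = T \<and> U l = T' \<and>
           (\<forall>m\<le>l. kary k (U m)) \<and>
           (\<forall>m<l. flip k (U m) (U (Suc m)))"
proof -
  have "symp (flip k)" using flip_sym by (auto intro: sympI)
  then have "(flip k)\<^sup>*\<^sup>* (left_comb k n) T'"
    using flips_to_left_comb[OF assms(1,3,5)] by (meson symp_rtranclp sympD)
  then have "(flip k)\<^sup>*\<^sup>* T T'"
    using flips_to_left_comb[OF assms(1,2,4)] by (auto intro: rtranclp_trans)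
  then obtain l where "(flip k ^^ l) T T'" by (auto dest: rtranclp_imp_relpowp)
  then obtain U where U: "U 0 = T" "U l = T'" "\<forall>m<l. flip k (U m) (U (Suc m))"
    by (auto simp: relpowp_fun_conv)
  have "kary k (U m)" if "m \<le> l" for m
  proof (cases "m = l")
    case True
    then show ?thesis using U(2) assms(3) by simp
  next
    case False
    then show ?thesis using U(3) that by (simp add: flip_def)
  qed
  then show ?thesis using U by blast
qed

end
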